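(* Let $(X,d)$ be a metric space, let $D_n\subset X$ and $f_n:D_n\to D_{n+1}$ be maps for $n\ge 0$, and consider the non-autonomous system $x_{n+1}=f_n(x_n)$, $n\ge 0$. Let $V$ be a bounded and infinite subset of $D_0$. Assume that $\{f_n\}_{n=0}^\infty$ is equi-continuous in $\{D_n\}_{n=0}^\infty$ and that the system has a fixed point in $V$. If the system is topologically transitive in $V$ and $P(f_{0,\infty})\cap V$ is dense in $V$, then the system is sensitive in $V$.
   Context: Notation: $f_0^0=\mathrm{id}$ and $f_0^n=f_{n-1}\circ\cdots\circ f_0$ on $D_0$ for $n\ge1$. A point $p\in D_0$ is $k$-periodic ($k\ge 1$) if $f_0^{n+k}(p)=f_0^n(p)$ for all $n\ge 0$; $P(f_{0,\infty})$ is the set of all periodic points (i.e., $k$-periodic for some $k\geq 1$). A fixed point of the system is a $1$-periodic point, i.e., a point $p$ with $f_n(p)=p$ for all $n\ge 0$. $\{f_n\}_{n=0}^\infty$ is equi-continuous in $\{D_n\}_{n=0}^\infty$ if for every $\varepsilon>0$ there is $\delta>0$ such that $d(f_n(x),f_n(y))<\varepsilon$ for all $n\ge 0$ and all $x,y\in D_n$ with $d(x,y)<\delta$. The system is topologically transitive in a nonempty $V\subset D_0$ if for any two nonempty relatively open subsets $U_0,V_0$ of $V$ there is an integer $n\ge 1$ with $f_0^n(U_0)\cap V_0\ne\emptyset$. The system is sensitive in a nonempty $V\subset D_0$ if there is a constant $\delta_0>0$ such that for every $x_0\in V$ and every neighborhood $U$ of $x_0$ there exist $y_0\in V\cap U$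 and a positive integer $n$ with $d(f_0^n(x_0),f_0^n(y_0))>\delta_0$. *)

theory Defs
  imports "HOL-Analysis.Analysis"
begin

text \<open>
  A non-autonomous system consists of sets \<open>D n\<close> and maps \<open>f n\<close> from \<open>D n\<close> to \<open>D (Suc n)\<close>.  The maps are
  total functions in HOL; their values outside \<open>D n\<close> are irrelevant to all notions below.
\<close>

definition nonauto_system :: "(nat \<Rightarrow> 'a set) \<Rightarrow> (nat \<Rightarrow> 'a \<Rightarrow> 'a) \<Rightarrow> bool" where
  "nonauto_system D f \<longleftrightarrow> (\<forall>n. f n \<in> D n \<rightarrow> D (Suc n))"

primrec iter0 :: "(nat \<Rightarrow> 'a \<Rightarrow> 'a) \<Rightarrow> nat \<Rightarrow> 'a \<Rightarrow> 'a" where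
  "iter0 f 0 = id"
| "iter0 f (Suc n) = f n \<circ> iter0 f n"

definition periodic_point ::
    "(nat \<Rightarrow> 'a set) \<Rightarrow> (nat \<Rightarrow> 'a \<Rightarrow> 'a) \<Rightarrow> nat \<Rightarrow> 'a \<Rightarrow> bool" where
  "periodic_point D f k p \<longleftrightarrow>
     k \<ge> 1 \<and> p \<in> D 0 \<and> (\<forall>n. iter0 f (n + k) p = iter0 f n p)"

definition periodic_points :: "(nat \<Rightarrow> 'a set) \<Rightarrow> (nat \<Rightarrow> 'a \<Rightarrow> 'a) \<Rightarrow> 'a set" where
  "periodic_points D f = {p. \<exists>k. periodic_point D f k p}"

definition fixed_point :: "(nat \<Rightarrow> 'a set) \<Rightarrow> (nat \<Rightarrow> 'a \<Rightarrow> 'a) \<Rightarrow> 'a \<Rightarrow> bool" where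
  "fixed_point D f p \<longleftrightarrow> periodic_point D f 1 p"

lemma fixed_point_iff: "fixed_point D f p \<longleftrightarrow> p \<in> D 0 \<and> (\<forall>n. f n p = p)"
proof -
  have 1: "iter0 f n p = p" if "\<forall>n. f n p = p" for n
    using that by (induction n) auto
  have 2: "iter0 f n p = p" if "\<forall>n. iter0 f (Suc n) p = iter0 f n p" for n
    by (induction n) (use that in \<open>auto simp del: iter0.simps(2)\<close>)
  have "(\<forall>n. iter0 f (Suc n) p = iter0 f n p) \<longleftrightarrow> (\<forall>n. f n p = p)"
  proof
    assume h: "\<forall>n. iter0 f (Suc n) p = iter0 f n p"
    show "\<forall>n. f n p = p"
    proof
      fix n
      show "f n p = p"
        using 2[OF h, of n] 2[OF h, of "Suc n"] by simp
    qed
  next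
    assume h: "\<forall>n. f n p = p"
    show "\<forall>n. iter0 f (Suc n) p = iter0 f n p"
      using 1[OF h] by metis
  qed
  then show ?thesis
    by (simp add: fixed_point_def periodic_point_def)
qed

definition equi_continuous ::
    "(nat \<Rightarrow> 'a::metric_space set) \<Rightarrow> (nat \<Rightarrow> 'a \<Rightarrow> 'a) \<Rightarrow> bool" where
  "equi_continuous D f \<longleftrightarrow>
     (\<forall>\<epsilon>>0. \<exists>\<delta>>0. \<forall>n. \<forall>x\<in>D n. \<forall>y\<in>D n. dist x y < \<delta> \<longrightarrow> dist (f n x) (f n y) < \<epsilon>)"

definition topologically_transitive_in ::
    "(nat \<Rightarrow> 'a::metric_space set) \<Rightarrow> (nat \<Rightarrow> 'a \<Rightarrow> 'a) \<Rightarrow> 'a set \<Rightarrow> bool" where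
  "topologically_transitive_in D f V \<longleftrightarrow> V \<noteq> {} \<and> V \<subseteq> D 0 \<and>
     (\<forall>U0 V0. openin (top_of_set V) U0 \<and> U0 \<noteq> {} \<and> openin (top_of_set V) V0 \<and> V0 \<noteq> {} \<longrightarrow>
        (\<exists>n\<ge>1. iter0 f n ` U0 \<inter> V0 \<noteq> {}))"

definition sensitive_in ::
    "(nat \<Rightarrow> 'a::metric_space set) \<Rightarrow> (nat \<Rightarrow> 'a \<Rightarrow> 'a) \<Rightarrow> 'a set \<Rightarrow> bool" where
  "sensitive_in D f V \<longleftrightarrow> V \<noteq> {} \<and> V \<subseteq> D 0 \<and>
     (\<exists>\<delta>0>0. \<forall>x0\<in>V. \<forall>U. x0 \<in> interior U \<longrightarrow>
        (\<exists>y0\<in>V \<inter> U. \<exists>n\<ge>1. dist (iter0 f n x0) (iter0 f n y0) > \<delta>0))"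

end

theory Submission
  imports Defs
begin

text \<open>
  Let \<open>p\<close> be the fixed point, \<open>q \<noteq> p\<close> another point of \<open>V\<close>, and \<open>\<delta> = d(p,q)/6\<close>.  Suppose that near
  some \<open>x\<close> all orbits stay \<open>\<delta>\<close>-close to that of \<open>x\<close>, and let \<open>z\<close> be a nearby point of period \<open>k\<close>.
  By transitivity some nearby orbit comes so close to \<open>p\<close> that, by equi-continuity, it stays there for
  \<open>k\<close> steps.  So the orbit of \<open>z\<close> is \<open>3\<delta>\<close>-close to \<open>p\<close> over a full period, hence always.
  Some other nearby orbit comes \<open>\<delta>\<close>-close to \<open>q\<close>, and at that time \<open>z\<close> is \<open>3\<delta>\<close>-close to \<open>q\<close>, which
  contradicts \<open>d(p,q) = 6\<delta>\<close>.
\<close>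

lemma iter0_in:
  assumes "nonauto_system D f" "x \<in> D 0"
  shows "iter0 f n x \<in> D n"
  using assms by (induction n) (auto simp: nonauto_system_def)

lemma iter0_fixed_point:
  assumes "fixed_point D f p"
  shows "iter0 f n p = p"
  using assms by (induction n) (auto simp: fixed_point_iff)

lemma periodic_point_add_mult:
  assumes "periodic_point D f k p"
  shows "iter0 f (n + k * j) p = iter0 f n p"
proof (induction j)
  case (Suc j)
  have "iter0 f (n + k * Suc j) p = iter0 f ((n + k * j) + k) p"
    by (simp add: add_ac)
  then show ?case
    using assms Suc by (simp add: periodic_point_def)
qed simp

text \<open>Any \<open>k\<close> consecutive times represent all residues modulo \<open>k\<close>.
  The case \<open>n < m\<close> is covered too, since the orbit has no preperiod.\<close>

lemma periodic_point_orbit_window: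
  assumes "periodic_point D f k p"
  shows "\<exists>i<k. iter0 f n p = iter0 f (m + i) p"
proof -
  have k: "k \<ge> 1"
    using assms by (simp add: periodic_point_def)
  \<comment> \<open>This is the residue of \<open>n - m\<close>; adding \<open>k * m\<close> keeps
    the subtraction from truncating.\<close>
  define r where "r = (n + k * m - m) mod k"
  have "m \<le> n + k * m"
    using k by (simp add: trans_le_add2)
  then have eq: "n + k * m = (m + r) + k * ((n + k * m - m) div k)"
    unfolding r_def by (metis add.assoc le_add_diff_inverse mod_mult_div_eq)
  have "iter0 f n p = iter0 f (m + r) p"
    by (metis eq periodic_point_add_mult[OF assms])
  moreover have "r < k"
    using k by (simp add: r_def)
  ultimately show ?thesis
    by blast
qed

text \<open>Uniformity in the starting time \<open>m\<close> is the point: transitivity supplies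
  that time only after the bound has been fixed.\<close>

lemma equi_continuous_iter0:
  assumes "nonauto_system D f" "equi_continuous D f" "\<epsilon> > 0"
  shows "\<exists>\<delta>>0. \<forall>m. \<forall>x\<in>D 0. \<forall>y\<in>D 0. dist (iter0 f m x) (iter0 f m y) < \<delta> \<longrightarrow>
           (\<forall>i\<le>k. dist (iter0 f (m + i) x) (iter0 f (m + i) y) < \<epsilon>)"
proof (induction k)
  case 0
  then show ?case
    using assms(3) by auto
next
  case (Suc k)
  then obtain \<delta> where \<delta>: "\<delta> > 0"
    and near: "\<And>m x y i. \<lbrakk>x \<in> D 0; y \<in> D 0; dist (iter0 f m x) (iter0 f m y) < \<delta>; i \<le> k\<rbrakk>
           \<Longrightarrow> dist (iter0 f (m + i) x) (iter0 f (m + i) y) < \<epsilon>"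
    by blast
  obtain \<eta> where \<eta>: "\<eta> > 0"
    and step: "\<And>n x y. \<lbrakk>x \<in> D n; y \<in> D n; dist x y < \<eta>\<rbrakk> \<Longrightarrow> dist (f n x) (f n y) < \<delta>"
    using assms(2) \<delta> unfolding equi_continuous_def by meson
  show ?case
  proof (intro exI conjI allI ballI impI)
    \<comment> \<open>Closeness below \<open>\<eta>\<close> gives distance below
      \<open>\<delta>\<close> at time \<open>Suc m\<close>, where the induction hypothesis takes
      over; \<open>\<epsilon>\<close> handles \<open>i = 0\<close>.\<close>
    show "min \<eta> (min \<epsilon> \<delta>) > 0"
      using \<delta> \<eta> assms(3) by simp
    fix m x y i
    assume x: "x \<in> D 0" and y: "y \<in> D 0" and i: "i \<le> Suc k"
      and d: "dist (iter0 f m x) (iter0 f m y) < min \<eta> (min \<epsilon> \<delta>)"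
    have "dist (iter0 f (Suc m) x) (iter0 f (Suc m) y) < \<delta>"
      using step[of "iter0 f m x" m "iter0 f m y"] d iter0_in[OF assms(1)] x y by simp
    from near[OF x y this, of "i - 1"]
    show "dist (iter0 f (m + i) x) (iter0 f (m + i) y) < \<epsilon>"
      using d i by (cases i) auto
  qed
qed

lemma transitive_visits_ball:
  assumes "topologically_transitive_in D f V"
    and "open U" "U \<inter> V \<noteq> {}" "q \<in> V" "e > 0"
  obtains y n where "y \<in> V" "y \<in> U" "n \<ge> 1" "dist (iter0 f n y) q < e"
proof -
  have "openin (top_of_set V) (V \<inter> U)" "openin (top_of_set V) (V \<inter> ball q e)"
    using assms(2) by (auto intro: openin_open_Int)
  moreover have "V \<inter> U \<noteq> {}" "V \<inter> ball q e \<noteq> {}"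
    using assms(3-5) by auto
  ultimately obtain n where "n \<ge> 1" "iter0 f n ` (V \<inter> U) \<inter> (V \<inter> ball q e) \<noteq> {}"
    using assms(1) unfolding topologically_transitive_in_def by metis
  then show thesis
    using that by (auto simp: dist_commute)
qed

theorem theorem3p2:
  fixes D :: "nat \<Rightarrow> 'a::metric_space set"
    and f :: "nat \<Rightarrow> 'a \<Rightarrow> 'a"
    and V :: "'a set"
  assumes "nonauto_system D f"
    and "V \<subseteq> D 0" and "bounded V" and "infinite V"
    and "equi_continuous D f"
    and "\<exists>p\<in>V. fixed_point D f p"
    and "topologically_transitive_in D f V"
    and "V \<subseteq> closure (periodic_points D f \<inter> V)"
  shows "sensitive_in D f V"
proof -
  obtain p where p: "p \<in> V" "fixed_point D f p"
    using assms(6) by blast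
  obtain q where q: "q \<in> V" "q \<noteq> p"
    using assms(4) by (metis finite.emptyI finite_insert finite_subset insertCI subsetI)
  \<comment> \<open>Six: the orbit of \<open>z\<close> is joined to each of \<open>p\<close> and
    \<open>q\<close> by three distances of at most \<open>\<delta>\<close>.\<close>
  define \<delta> where "\<delta> = dist p q / 6"
  have \<delta>: "\<delta> > 0"
    using q by (simp add: \<delta>_def)
  have sens: "\<exists>y\<in>V \<inter> U. \<exists>n\<ge>1. dist (iter0 f n x) (iter0 f n y) > \<delta>"
    if x: "x \<in> V" "x \<in> interior U" for x U
  proof (rule ccontr)
    assume "\<not> ?thesis"
    then have shadow: "dist (iter0 f n x) (iter0 f n y) \<le> \<delta>"
      if "y \<in> V" "y \<in> interior U" "n \<ge> 1" for y n
      using that interior_subset[of U] by (meson IntI not_le subsetD)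
    have "periodic_points D f \<inter> V \<inter> interior U \<noteq> {}"
      using x assms(8) open_Int_closure_eq_empty[OF open_interior[of U]] by blast
    then obtain z k where z: "z \<in> V" "z \<in> interior U" and per: "periodic_point D f k z"
      by (auto simp: periodic_points_def)
    \<comment> \<open>The period \<open>k\<close> is already known here, so \<open>\<eta>\<close>
      can be chosen to cover a full period.\<close>
    obtain \<eta> where \<eta>: "\<eta> > 0"
      and stay: "\<And>m y i. \<lbrakk>y \<in> D 0; dist (iter0 f m y) (iter0 f m p) < \<eta>; i \<le> k\<rbrakk>
           \<Longrightarrow> dist (iter0 f (m + i) y) (iter0 f (m + i) p) < \<delta>"
      using equi_continuous_iter0[OF assms(1,5) \<delta>, of k] p assms(2) by blast
    have U: "interior U \<inter> V \<noteq> {}"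
      using x by blast
    obtain y1 m where y1: "y1 \<in> V" "y1 \<in> interior U" "m \<ge> 1" "dist (iter0 f m y1) p < \<eta>"
      using transitive_visits_ball[OF assms(7) open_interior U p(1) \<eta>] by blast
    obtain y2 n where y2: "y2 \<in> V" "y2 \<in> interior U" "n \<ge> 1" "dist (iter0 f n y2) q < \<delta>"
      using transitive_visits_ball[OF assms(7) open_interior U q(1) \<delta>] by blast
    \<comment> \<open>Moves time \<open>n\<close> of the orbit of \<open>z\<close> into the period
      after \<open>m\<close>, during which \<open>y1\<close> stays near \<open>p\<close>.\<close>
    obtain i where i: "i < k" "iter0 f n z = iter0 f (m + i) z"
      using periodic_point_orbit_window[OF per] by blast
    have "dist (iter0 f (m + i) y1) p < \<delta>"
      using stay[of y1 m i] y1 i assms(2) by (auto simp: iter0_fixed_point[OF p(2)])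
    moreover have "dist (iter0 f (m + i) x) (iter0 f (m + i) y1) \<le> \<delta>"
      "dist (iter0 f (m + i) x) (iter0 f (m + i) z) \<le> \<delta>"
      using shadow y1 z by simp_all
    \<comment> \<open>The chain runs from \<open>z\<close> via \<open>x\<close> and
      \<open>y1\<close> to \<open>p\<close>, all at time \<open>m + i\<close>.\<close>
    ultimately have "dist (iter0 f n z) p < 3 * \<delta>"
      using dist_triangle[of "iter0 f (m + i) z" p "iter0 f (m + i) x"]
        dist_triangle[of "iter0 f (m + i) x" p "iter0 f (m + i) y1"]
      by (simp add: i(2) dist_commute)
    moreover have "dist (iter0 f n x) (iter0 f n y2) \<le> \<delta>" "dist (iter0 f n x) (iter0 f n z) \<le> \<delta>"
      using shadow y2 z by simp_all
    then have "dist (iter0 f n z) q < 3 * \<delta>"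
      using y2(4) dist_triangle[of "iter0 f n z" q "iter0 f n x"]
        dist_triangle[of "iter0 f n x" q "iter0 f n y2"]
      by (simp add: dist_commute)
    ultimately have "dist p q < 6 * \<delta>"
      using dist_triangle[of p q "iter0 f n z"] by (simp add: dist_commute)
    then show False
      by (simp add: \<delta>_def)
  qed
  show ?thesis
    unfolding sensitive_in_def using assms(2) p(1) \<delta> sens by blast
qed

end
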